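(* In the setting described in the context, suppose $q_i>0$ for all $i$ and $\kappa>0$, where $$\kappa=2\lambda\pi\sum_{m=1}^{M-L+1}(-1)^{m+1}\binom{M-L+1}{m}\int_0^D y\,e^{-\frac{\eta\beta m y^{\alpha_i}}{P}\sigma^2}\mathcal{L}_{\mathcal{I}_o}\!\left(\frac{\eta\beta m y^{\alpha_i}}{P}\right)\mathrm{d}y.$$ Then the optimal solution of the problem (Problem 2, best selection) $$\max_{p_1,\dots,p_N}\ \sum_{i=1}^{N}q_i\left\{1-e^{-\kappa p_i}\right\}\quad\text{subject to}\quad\sum_{i=1}^N p_i\le N_c,\quad 0\le p_i\le 1\ \ (i=1,\dots,N)$$ is $$p_i^{*}=\left.\frac{v-\ln\left(\frac{1}{q_i}\right)}{\kappa}\right|_0^1,\qquad i=1,\dots,N,$$ where $v\in\mathbb{R}$ is determined by the constraint $\sum_{i=1}^N p_i^{*}=N_c$.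
   Context: For real $x$, $x\big|_0^1$ equals $0$ if $x<0$, $x$ if $0\le x\le1$, and $1$ if $x>1$. Parameters: integers $M\ge1$, $N>N_c\ge 1$; reals $\lambda,\lambda_p,D,P,\beta>0$, $\sigma^2\ge0$, $d_g\ge 0$, pathloss exponents $0<\alpha_i<\alpha_o$ (the subscript in $\alpha_i$ is a label, unrelated to the file index $i$); a probability vector $q_1\ge\dots\ge q_N$, $\sum_i q_i=1$. Here $p_i$ is the probability that a radio unit (RU) caches file $i$, $q_i$ the request probability of file $i$, $N_c$ the cache memory size. $L=\min\{M,\lfloor\lambda\pi D^2\rfloor\}$ and $\eta=\bigl((M-L+1)!\bigr)^{-1/(M-L+1)}$. $\mathcal{L}_{\mathcal{I}_o}(s)=\mathbb{E}\{e^{-s\mathcal{I}_o}\}$ is the Laplace transform of the nonnegative random variable $$\mathcal{I}_o=\sum_{\mathbf{x}\in\Phi_p}\sum_{\mathbf{y}\in\mathcal{A}_{\mathbf{x}}}P f_{\mathbf{y}}\|\mathbf{y}\|^{-\alpha_o},$$ the out of cloud interference: $\Phi_p$ is a homogeneous Poisson point process on $\mathbb{R}^2$ of intensity $\lambda_p$; given $\Phi_p$, for each $\mathbf{x}\in\Phi_p$, $\Phi_{\mathbf{x}}$ is an independent homogeneous Poisson point process of intensity $\lambda$ on the disk of center $\mathbf{x}$ and radius $D$; $\mathcal{A}_{\mathbf{x}}$ consists of $\min\{M,n\}$ of the $n$ points of $\Phi_{\mathbf{x}}$ at distance more than $d_g$ from the origin, chosen uniformly at random; the $f_{\mathbf{y}}$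 are i.i.d. unit-mean exponential, independent of the locations. *)

theory Defs
  imports "HOL-Probability.Probability"
begin

section \<open>Homogeneous Poisson point processes\<close>

text \<open>
  A point process is a random set of points. As \<open>card\<close> of an infinite set is 0, almost
  sure local finiteness is required explicitly. The Poisson law is written out because
  \<open>poisson_pmf\<close> excludes rate 0, which occurs for null sets.
\<close>

definition homogeneous_ppp ::
  "'w measure \<Rightarrow> real \<Rightarrow> 'a::euclidean_space set \<Rightarrow> ('w \<Rightarrow> 'a set) \<Rightarrow> bool" where
  "homogeneous_ppp \<Omega> \<rho> W \<Phi> \<longleftrightarrow>
     (AE \<omega> in \<Omega>. \<Phi> \<omega> \<subseteq> W) \<and>
     (\<forall>B \<in> sets borel. bounded B \<longrightarrow> B \<subseteq> W \<longrightarrow>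
        (AE \<omega> in \<Omega>. finite (\<Phi> \<omega> \<inter> B)) \<and>
        (\<lambda>\<omega>. card (\<Phi> \<omega> \<inter> B)) \<in> measurable \<Omega> (count_space UNIV) \<and>
        (\<forall>n. measure \<Omega> {\<omega> \<in> space \<Omega>. card (\<Phi> \<omega> \<inter> B) = n} =
             exp (- (\<rho> * measure lborel B)) * (\<rho> * measure lborel B) ^ n / fact n)) \<and>
     (\<forall>B :: nat \<Rightarrow> 'a set.
        (\<forall>j. B j \<in> sets borel \<and> bounded (B j) \<and> B j \<subseteq> W) \<longrightarrow> disjoint_family B \<longrightarrow>
        prob_space.indep_vars \<Omega> (\<lambda>_. count_space UNIV) (\<lambda>j \<omega>. card (\<Phi> \<omega> \<inter> B j)) UNIV)"

text \<open>Independence of two random elements with values in different types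
  (\<open>indep_var\<close> needs a common value type).\<close>

definition indep_elements ::
  "'w measure \<Rightarrow> 'a measure \<Rightarrow> ('w \<Rightarrow> 'a) \<Rightarrow> 'b measure \<Rightarrow> ('w \<Rightarrow> 'b) \<Rightarrow> bool" where
  "indep_elements \<Omega> MA A MB B \<longleftrightarrow>
     A \<in> measurable \<Omega> MA \<and> B \<in> measurable \<Omega> MB \<and>
     prob_space.indep_set \<Omega> {A -` S \<inter> space \<Omega> | S. S \<in> sets MA}
                            {B -` S \<inter> space \<Omega> | S. S \<in> sets MB}"

section \<open>The out of cloud interference\<close>

text \<open>
  Points are enumerated, so that fading variables can be attached to them measurably:
  \<^item> \<open>X k\<close> is the \<open>k\<close>-th point of the parent process;
  \<^item> the cluster of \<open>X k\<close> consists of the \<open>\<nu> k\<close> points \<open>Y k j\<close>, \<open>j < \<nu> k\<close>;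
  \<^item> \<open>S k\<close> is the set of the indices \<open>j\<close> of the selected points of that cluster;
  \<^item> \<open>F k j\<close> is the fading variable of \<open>Y k j\<close>.
\<close>

type_synonym plane = "real ^ 2"

definition far_indices ::
  "real \<Rightarrow> (nat \<Rightarrow> 'w \<Rightarrow> nat) \<Rightarrow> (nat \<Rightarrow> nat \<Rightarrow> 'w \<Rightarrow> plane) \<Rightarrow> nat \<Rightarrow> 'w \<Rightarrow> nat set" where
  "far_indices d\<^sub>g \<nu> Y k \<omega> = {j. j < \<nu> k \<omega> \<and> norm (Y k j \<omega>) > d\<^sub>g}"

definition selections ::
  "nat \<Rightarrow> real \<Rightarrow> (nat \<Rightarrow> 'w \<Rightarrow> nat) \<Rightarrow> (nat \<Rightarrow> nat \<Rightarrow> 'w \<Rightarrow> plane) \<Rightarrow> nat \<Rightarrow> 'w \<Rightarrow> nat set set"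
  where
  "selections M d\<^sub>g \<nu> Y k \<omega> =
     {T. T \<subseteq> far_indices d\<^sub>g \<nu> Y k \<omega> \<and> card T = min M (card (far_indices d\<^sub>g \<nu> Y k \<omega>))}"

abbreviation parents_space :: "(nat \<Rightarrow> plane) measure" where
  "parents_space \<equiv> PiM UNIV (\<lambda>_. borel)"

abbreviation cluster_space :: "(nat \<times> (nat \<Rightarrow> plane)) measure" where
  "cluster_space \<equiv> count_space UNIV \<Otimes>\<^sub>M PiM UNIV (\<lambda>_. borel)"

abbreviation config_space :: "((nat \<Rightarrow> plane) \<times> (nat \<Rightarrow> nat \<times> (nat \<Rightarrow> plane))) measure" where
  "config_space \<equiv> parents_space \<Otimes>\<^sub>M PiM UNIV (\<lambda>_. cluster_space)"

definition config ::
  "(nat \<Rightarrow> 'w \<Rightarrow> plane) \<Rightarrow> (nat \<Rightarrow> 'w \<Rightarrow> nat) \<Rightarrow> (nat \<Rightarrow> nat \<Rightarrow> 'w \<Rightarrow> plane) \<Rightarrow>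
   'w \<Rightarrow> (nat \<Rightarrow> plane) \<times> (nat \<Rightarrow> nat \<times> (nat \<Rightarrow> plane))" where
  "config X \<nu> Y \<omega> = ((\<lambda>k. X k \<omega>), (\<lambda>k. (\<nu> k \<omega>, (\<lambda>j. Y k j \<omega>))))"

text \<open>
  Given the parents, the clusters are independent Poisson processes on discs centred at the
  parents: equivalently, the clusters translated to the origin are i.i.d. Poisson processes on
  the centred disc and independent of the parents. The assumption \<open>selection_uniform\<close> is the
  conditional law of the selections given all the locations.
\<close>

locale clustered_network = prob_space \<Omega>
  for \<Omega> :: "'w measure" +
  fixes M :: nat and lam lam\<^sub>p D d\<^sub>g :: real
    and X :: "nat \<Rightarrow> 'w \<Rightarrow> plane"
    and \<nu> :: "nat \<Rightarrow> 'w \<Rightarrow> nat"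
    and Y :: "nat \<Rightarrow> nat \<Rightarrow> 'w \<Rightarrow> plane"
    and S :: "nat \<Rightarrow> 'w \<Rightarrow> nat set"
    and F :: "nat \<Rightarrow> nat \<Rightarrow> 'w \<Rightarrow> real"
  assumes parents_distinct: "AE \<omega> in \<Omega>. inj (\<lambda>k. X k \<omega>)"
    and parents_ppp: "homogeneous_ppp \<Omega> lam\<^sub>p UNIV (\<lambda>\<omega>. range (\<lambda>k. X k \<omega>))"
    and cluster_distinct: "\<And>k. AE \<omega> in \<Omega>. inj_on (\<lambda>j. Y k j \<omega>) {..<\<nu> k \<omega>}"
    and cluster_ppp:
      "\<And>k. homogeneous_ppp \<Omega> lam (cball 0 D) (\<lambda>\<omega>. (\<lambda>j. Y k j \<omega> - X k \<omega>) ` {..<\<nu> k \<omega>})"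
    and clusters_indep:
      "indep_vars (\<lambda>_. cluster_space) (\<lambda>k \<omega>. (\<nu> k \<omega>, (\<lambda>j. Y k j \<omega> - X k \<omega>))) UNIV"
    and clusters_indep_parents:
      "indep_elements \<Omega> parents_space (\<lambda>\<omega> k. X k \<omega>)
         (PiM UNIV (\<lambda>_. cluster_space)) (\<lambda>\<omega> k. (\<nu> k \<omega>, (\<lambda>j. Y k j \<omega> - X k \<omega>)))"
    and selection_measurable: "\<And>k. S k \<in> measurable \<Omega> (count_space UNIV)"
    and selection_mem: "\<And>k. AE \<omega> in \<Omega>. S k \<omega> \<in> selections M d\<^sub>g \<nu> Y k \<omega>"
    and selection_uniform:
      "\<And>C J T. C \<in> sets config_space \<Longrightarrow> finite J \<Longrightarrow>
         prob {\<omega> \<in> space \<Omega>. config X \<nu> Y \<omega> \<in> C \<and> (\<forall>k \<in> J. S k \<omega> = T k)} =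
         expectation (\<lambda>\<omega>. indicator C (config X \<nu> Y \<omega>) *
           (\<Prod>k \<in> J. pmf (pmf_of_set (selections M d\<^sub>g \<nu> Y k \<omega>)) (T k)))"
    and fading_exponential: "\<And>k j. distributed \<Omega> lborel (F k j) (exponential_density 1)"
    and fading_indep: "indep_vars (\<lambda>_. borel) (\<lambda>(k, j). F k j) UNIV"
    and fading_indep_locations:
      "indep_elements \<Omega> (PiM UNIV (\<lambda>_. borel)) (\<lambda>\<omega> (k, j). F k j \<omega>)
         (config_space \<Otimes>\<^sub>M PiM UNIV (\<lambda>_. count_space UNIV))
         (\<lambda>\<omega>. (config X \<nu> Y \<omega>, (\<lambda>k. S k \<omega>)))"

text \<open>The interference takes values in \<open>[0, \<infinity>]\<close>: for small pathloss exponents the sum diverges,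
  and a real-valued series would then silently be meaningless.\<close>

definition interference ::
  "real \<Rightarrow> real \<Rightarrow> (nat \<Rightarrow> nat \<Rightarrow> 'w \<Rightarrow> plane) \<Rightarrow> (nat \<Rightarrow> 'w \<Rightarrow> nat set) \<Rightarrow>
   (nat \<Rightarrow> nat \<Rightarrow> 'w \<Rightarrow> real) \<Rightarrow> 'w \<Rightarrow> ennreal" where
  "interference P \<alpha>\<^sub>o Y S F \<omega> =
     (\<Sum>k. \<Sum>j \<in> S k \<omega>. ennreal (P * F k j \<omega> * norm (Y k j \<omega>) powr (- \<alpha>\<^sub>o)))"

definition laplace_transform :: "'w measure \<Rightarrow> ('w \<Rightarrow> ennreal) \<Rightarrow> real \<Rightarrow> real" where
  "laplace_transform \<Omega> I s =
     (LINT \<omega>|\<Omega>. (if ennreal s * I \<omega> = \<infinity> then 0 else exp (- enn2real (ennreal s * I \<omega>))))"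

section \<open>The caching problem\<close>

definition coop_L :: "nat \<Rightarrow> real \<Rightarrow> real \<Rightarrow> nat" where
  "coop_L M lam D = min M (nat \<lfloor>lam * pi * D\<^sup>2\<rfloor>)"

definition coop_eta :: "nat \<Rightarrow> real \<Rightarrow> real \<Rightarrow> real" where
  "coop_eta M lam D =
     (let K = M - coop_L M lam D + 1 in (fact K :: real) powr (- 1 / real K))"

definition kappa ::
  "nat \<Rightarrow> real \<Rightarrow> real \<Rightarrow> real \<Rightarrow> real \<Rightarrow> real \<Rightarrow> real \<Rightarrow> (real \<Rightarrow> real) \<Rightarrow> real" where
  "kappa M lam D P \<beta> \<sigma>sq \<alpha>\<^sub>i Lap =
     (let K = M - coop_L M lam D + 1; \<eta> = coop_eta M lam D in
      2 * lam * pi * (\<Sum>m = 1..K. (- 1) ^ (m + 1) * real (K choose m) *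
        (LBINT y:{0..D}. y * exp (- (\<eta> * \<beta> * real m * y powr \<alpha>\<^sub>i / P) * \<sigma>sq) *
                         Lap (\<eta> * \<beta> * real m * y powr \<alpha>\<^sub>i / P))))"

definition clip01 :: "real \<Rightarrow> real" where
  "clip01 x = (if x < 0 then 0 else if x \<le> 1 then x else 1)"

text \<open>Vectors indexed by \<open>1, \<dots>, N\<close> are functions on \<open>nat\<close>; only the values on \<open>{1..N}\<close> matter.\<close>

definition caching_objective :: "nat \<Rightarrow> (nat \<Rightarrow> real) \<Rightarrow> real \<Rightarrow> (nat \<Rightarrow> real) \<Rightarrow> real" where
  "caching_objective N q \<kappa> p = (\<Sum>i = 1..N. q i * (1 - exp (- \<kappa> * p i)))"

definition caching_feasible :: "nat \<Rightarrow> nat \<Rightarrow> (nat \<Rightarrow> real) \<Rightarrow> bool" where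
  "caching_feasible N N\<^sub>c p \<longleftrightarrow>
     (\<Sum>i = 1..N. p i) \<le> real N\<^sub>c \<and> (\<forall>i \<in> {1..N}. 0 \<le> p i \<and> p i \<le> 1)"

definition caching_profile :: "(nat \<Rightarrow> real) \<Rightarrow> real \<Rightarrow> real \<Rightarrow> nat \<Rightarrow> real" where
  "caching_profile q \<kappa> v i = clip01 ((v - ln (1 / q i)) / \<kappa>)"

end

theory Submission
  imports Defs
begin

text \<open>
  Lagrangian duality: for the multiplier \<open>\<mu> = \<kappa> exp (- v)\<close> of the cardinality constraint, the
  penalised objective splits into the strictly concave functions
  \<open>q\<^sub>i (1 - exp (- \<kappa> x)) - \<mu> x\<close> of one variable, and clipping the stationary point
  \<open>(v - ln (1 / q\<^sub>i)) / \<kappa>\<close> to \<open>[0, 1]\<close> gives the unique maximiser of each of them. If the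
  profile exhausts the budget, the penalty can be dropped. Such a \<open>v\<close> exists by the
  intermediate value theorem.
\<close>

text \<open>In this form clipping is visibly continuous, which the intermediate value argument
  needs.\<close>

lemma clip01_eq: "clip01 x = max 0 (min 1 x)"
  by (auto simp: clip01_def)

lemma clip01_range: "0 \<le> clip01 x" "clip01 x \<le> 1"
  by (auto simp: clip01_def)

text \<open>Away from \<open>t\<close>, a strictly concave function lies strictly below its tangent
  at \<open>t\<close>. Since \<open>t\<close> is the point of [0, 1] nearest to the stationary
  point, that tangent does not rise from \<open>t\<close> towards any \<open>x\<close> in
  [0, 1].\<close>

lemma penalised_gain_less:
  fixes q \<kappa> v x :: real
  assumes "q > 0" "\<kappa> > 0" "0 \<le> x" "x \<le> 1"
  defines "t \<equiv> clip01 ((v - ln (1 / q)) / \<kappa>)"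
  assumes "x \<noteq> t"
  shows "q * (1 - exp (- \<kappa> * x)) - \<kappa> * exp (- v) * x
       < q * (1 - exp (- \<kappa> * t)) - \<kappa> * exp (- v) * t"
proof -
  define c where "c = v - ln (1 / q)"
  have t: "t = clip01 (c / \<kappa>)"
    by (simp add: t_def c_def)
  \<comment> \<open>Turns the derivative at \<open>t\<close> into
    \<open>\<kappa> * q * (exp (- \<kappa> * t) - exp (- c))\<close>, so that the stationary point
    is \<open>c / \<kappa>\<close>.\<close>
  have v: "exp (- v) = q * exp (- c)"
    using \<open>q > 0\<close> by (simp add: c_def ln_div exp_diff exp_minus field_simps)
  \<comment> \<open>First-order optimality on an interval: the slope is negative if \<open>t\<close>
    is clipped to 0, zero if \<open>t\<close> is not clipped, and positive if \<open>t\<close> is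
    clipped to 1.\<close>
  have "(exp (- \<kappa> * t) - exp (- c)) * (x - t) \<le> 0"
  proof -
    consider "c < 0" | "0 \<le> c" "c \<le> \<kappa>" | "c > \<kappa>" by linarith
    then show ?thesis
    proof cases
      case 1
      then have "t = 0" using \<open>\<kappa> > 0\<close> by (simp add: t clip01_def divide_neg_pos)
      then show ?thesis using 1 \<open>0 \<le> x\<close> by (simp add: mult_nonpos_nonneg)
    next
      case 2
      then have "\<kappa> * t = c" using \<open>\<kappa> > 0\<close> by (simp add: t clip01_def divide_less_0_iff)
      then show ?thesis by simp
    next
      case 3
      then have "t = 1" using \<open>\<kappa> > 0\<close> by (simp add: t clip01_def divide_less_0_iff)
      then show ?thesis using 3 \<open>x \<le> 1\<close> by (simp add: mult_nonneg_nonpos)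
    qed
  qed
  then have slope: "\<kappa> * q * ((exp (- \<kappa> * t) - exp (- c)) * (x - t)) \<le> 0"
    by (rule mult_nonneg_nonpos[rotated]) (use \<open>q > 0\<close> \<open>\<kappa> > 0\<close> in simp)
  \<comment> \<open>The tangent of exp at 0, strict because \<open>x \<noteq> t\<close>. Scaling by
    \<open>q * exp (- \<kappa> * t)\<close> moves the point of tangency to \<open>t\<close>.\<close>
  have "1 - \<kappa> * (x - t) < exp (- \<kappa> * (x - t))"
    using \<open>x \<noteq> t\<close> \<open>\<kappa> > 0\<close> exp_minus_greater[of "\<kappa> * (x - t)"] by simp
  then have "q * exp (- \<kappa> * t) * (1 - \<kappa> * (x - t)) < q * exp (- \<kappa> * t) * exp (- \<kappa> * (x - t))"
    using \<open>q > 0\<close> by simp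
  also have "\<dots> = q * exp (- \<kappa> * x)"
    by (simp add: mult.assoc flip: exp_add) (simp add: algebra_simps)
  finally show ?thesis
    using slope unfolding v by (simp add: algebra_simps)
qed

lemma objective_less_profile:
  fixes q :: "nat \<Rightarrow> real"
  assumes q_pos: "\<And>i. i \<in> {1..N} \<Longrightarrow> q i > 0" and "\<kappa> > 0"
    and budget: "(\<Sum>i = 1..N. caching_profile q \<kappa> v i) = real N\<^sub>c"
    and feasible: "caching_feasible N N\<^sub>c p"
    and differs: "\<exists>i \<in> {1..N}. p i \<noteq> caching_profile q \<kappa> v i"
  shows "caching_objective N q \<kappa> p < caching_objective N q \<kappa> (caching_profile q \<kappa> v)"
proof -
  define \<mu> where "\<mu> = \<kappa> * exp (- v)"
  define G where "G r i = q i * (1 - exp (- \<kappa> * r i)) - \<mu> * r i" for r :: "nat \<Rightarrow> real" and i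
  have G_sum: "(\<Sum>i = 1..N. G r i) = caching_objective N q \<kappa> r - \<mu> * (\<Sum>i = 1..N. r i)" for r
    by (simp add: G_def caching_objective_def sum_subtractf sum_distrib_left)
  have less: "G p i < G (caching_profile q \<kappa> v) i"
    if "i \<in> {1..N}" "p i \<noteq> caching_profile q \<kappa> v i" for i
    using penalised_gain_less[of "q i" \<kappa> "p i" v] q_pos \<open>\<kappa> > 0\<close> feasible that
    by (simp add: G_def \<mu>_def caching_profile_def caching_feasible_def)
  have "(\<Sum>i = 1..N. G p i) < (\<Sum>i = 1..N. G (caching_profile q \<kappa> v) i)"
  proof (rule sum_strict_mono_ex1)
    \<comment> \<open>Where \<open>p\<close> and the profile agree there is equality, as
      \<open>G r i\<close> depends on \<open>r\<close> only through \<open>r i\<close>.\<close>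
    show "\<forall>i \<in> {1..N}. G p i \<le> G (caching_profile q \<kappa> v) i"
      using less by (metis G_def order.refl order.strict_implies_order)
    show "\<exists>i \<in> {1..N}. G p i < G (caching_profile q \<kappa> v) i"
      using less differs by blast
  qed simp
  \<comment> \<open>As \<mu> is positive, \<open>p\<close> pays at most the penalty
    \<open>\<mu> * real N\<^sub>c\<close>, which the profile pays exactly.\<close>
  moreover have "\<mu> * (\<Sum>i = 1..N. p i) \<le> \<mu> * real N\<^sub>c"
    using feasible \<open>\<kappa> > 0\<close> by (simp add: \<mu>_def caching_feasible_def)
  ultimately show ?thesis
    unfolding G_sum budget by linarith
qed

lemma is_arg_max_iff_profile:
  fixes q :: "nat \<Rightarrow> real"
  assumes q_pos: "\<And>i. i \<in> {1..N} \<Longrightarrow> q i > 0" and "\<kappa> > 0"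
    and budget: "(\<Sum>i = 1..N. caching_profile q \<kappa> v i) = real N\<^sub>c"
  shows "is_arg_max (caching_objective N q \<kappa>) (caching_feasible N N\<^sub>c) p \<longleftrightarrow>
         (\<forall>i \<in> {1..N}. p i = caching_profile q \<kappa> v i)" (is "?max \<longleftrightarrow> ?eq")
proof
  note less = objective_less_profile[OF q_pos \<open>\<kappa> > 0\<close> budget]
  have profile: "caching_feasible N N\<^sub>c (caching_profile q \<kappa> v)"
    using budget by (simp add: caching_feasible_def caching_profile_def clip01_range)
  show ?eq if ?max
    using that less profile unfolding is_arg_max_def by blast
  show ?max if eq: ?eq
  proof -
    \<comment> \<open>A maximiser is a function on all of \<open>nat\<close> and may differ from the
      profile outside \<open>{1..N}\<close> without changing the objective.\<close>
    have same: "caching_objective N q \<kappa> r = caching_objective N q \<kappa> (caching_profile q \<kappa> v)"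
      if "\<forall>i \<in> {1..N}. r i = caching_profile q \<kappa> v i" for r
      using that by (simp add: caching_objective_def)
    have "caching_feasible N N\<^sub>c p"
      using profile eq by (simp add: caching_feasible_def)
    moreover have "\<not> caching_objective N q \<kappa> p < caching_objective N q \<kappa> r"
      \<comment> \<open>Either \<open>r\<close> differs from the profile somewhere on
        \<open>{1..N}\<close> and is strictly worse, or it has the same value.\<close>
      if "caching_feasible N N\<^sub>c r" for r
      using less[OF _ that] same[OF eq] same[of r] by fastforce
    ultimately show ?thesis
      by (auto simp: is_arg_max_def)
  qed
qed

lemma ex_profile_budget:
  fixes q :: "nat \<Rightarrow> real"
  assumes "\<kappa> > 0" "0 \<le> b" "b \<le> real N"
  shows "\<exists>v. (\<Sum>i = 1..N. caching_profile q \<kappa> v i) = b"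
proof -
  \<comment> \<open>A common bound for all the logarithms: at \<open>v = - B\<close> every argument
    of \<open>clip01\<close> is at most 0, and at \<open>v = \<kappa> + B\<close> at least 1, so the
    sum runs from 0 to \<open>real N\<close>.\<close>
  define B where "B = (\<Sum>i = 1..N. \<bar>ln (1 / q i)\<bar>)"
  have B: "\<bar>ln (1 / q i)\<bar> \<le> B" if "i \<in> {1..N}" for i
    unfolding B_def using that by (intro member_le_sum) auto
  have "0 \<le> B"
    by (simp add: B_def sum_nonneg)
  have "caching_profile q \<kappa> (- B) i = 0" if "i \<in> {1..N}" for i
    using B[OF that] \<open>\<kappa> > 0\<close> by (simp add: caching_profile_def clip01_eq divide_le_0_iff)
  then have low: "(\<Sum>i = 1..N. caching_profile q \<kappa> (- B) i) = 0"
    by simp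
  have "caching_profile q \<kappa> (\<kappa> + B) i = 1" if "i \<in> {1..N}" for i
    using B[OF that] \<open>\<kappa> > 0\<close> by (simp add: caching_profile_def clip01_eq)
  then have high: "(\<Sum>i = 1..N. caching_profile q \<kappa> (\<kappa> + B) i) = real N"
    by simp
  have "continuous_on {- B..\<kappa> + B} (\<lambda>v. \<Sum>i = 1..N. caching_profile q \<kappa> v i)"
    unfolding caching_profile_def clip01_eq using \<open>\<kappa> > 0\<close> by (intro continuous_intros) auto
  then show ?thesis
    using IVT'[of "\<lambda>v. \<Sum>i = 1..N. caching_profile q \<kappa> v i" "- B" b "\<kappa> + B"]
      low high assms \<open>0 \<le> B\<close> by auto
qed

theorem mainTheorem7:
  fixes \<Omega> :: "'w measure"
    and M N N\<^sub>c :: nat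
    and lam lam\<^sub>p D P \<beta> \<sigma>sq d\<^sub>g \<alpha>\<^sub>i \<alpha>\<^sub>o \<kappa> :: real
    and q :: "nat \<Rightarrow> real"
    and X :: "nat \<Rightarrow> 'w \<Rightarrow> plane"
    and \<nu> :: "nat \<Rightarrow> 'w \<Rightarrow> nat"
    and Y :: "nat \<Rightarrow> nat \<Rightarrow> 'w \<Rightarrow> plane"
    and S :: "nat \<Rightarrow> 'w \<Rightarrow> nat set"
    and F :: "nat \<Rightarrow> nat \<Rightarrow> 'w \<Rightarrow> real"
  assumes "M \<ge> 1" and "N\<^sub>c \<ge> 1" and "N > N\<^sub>c"
    and "lam > 0" and "lam\<^sub>p > 0" and "D > 0" and "P > 0" and "\<beta> > 0"
    and "\<sigma>sq \<ge> 0" and "d\<^sub>g \<ge> 0" and "0 < \<alpha>\<^sub>i" and "\<alpha>\<^sub>i < \<alpha>\<^sub>o"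
    and network: "clustered_network \<Omega> M lam lam\<^sub>p D d\<^sub>g X \<nu> Y S F"
    and q_pos: "\<And>i. i \<in> {1..N} \<Longrightarrow> q i > 0"
    and q_decreasing: "\<And>i j. 1 \<le> i \<Longrightarrow> i \<le> j \<Longrightarrow> j \<le> N \<Longrightarrow> q j \<le> q i"
    and q_sum: "(\<Sum>i = 1..N. q i) = 1"
    and kappa_eq: "\<kappa> = kappa M lam D P \<beta> \<sigma>sq \<alpha>\<^sub>i
                           (laplace_transform \<Omega> (interference P \<alpha>\<^sub>o Y S F))"
    and kappa_pos: "\<kappa> > 0"
  shows "(\<exists>v. (\<Sum>i = 1..N. caching_profile q \<kappa> v i) = real N\<^sub>c) \<and>
         (\<forall>v. (\<Sum>i = 1..N. caching_profile q \<kappa> v i) = real N\<^sub>c \<longrightarrow>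
            (\<forall>p. is_arg_max (caching_objective N q \<kappa>) (caching_feasible N N\<^sub>c) p \<longleftrightarrow>
                 (\<forall>i \<in> {1..N}. p i = caching_profile q \<kappa> v i)))"
  using ex_profile_budget[of \<kappa> "real N\<^sub>c" N q] is_arg_max_iff_profile[of N q \<kappa>]
    q_pos kappa_pos \<open>N > N\<^sub>c\<close> by auto

end
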